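(* For all integers $d, n \geq 1$, all vectors $v_1, \dots, v_n \in \mathbb{R}^d$ whose linear span is $2$-dimensional, and every $t > 0$, \[ \mathbb{P}\left(|\varepsilon_1v_1 + \dots + \varepsilon_nv_n| \geq t\right) \leq C\, \mathbb{P}\left(|g_1v_1+\dots+g_nv_n| \geq t\right) \] with $C = 3824$.
   Context: Here $\varepsilon_1, \varepsilon_2, \dots$ are independent Rademacher random variables (each takes the values $+1$ and $-1$ with probability $\frac12$), $g_1, g_2, \dots$ are independent standard Gaussian (mean $0$, variance $1$) real random variables, and $|x| = \sqrt{\sum_{j=1}^d x_j^2}$ denotes the Euclidean norm on $\mathbb{R}^d$. *)

theory Defs
  imports "HOL-Probability.Probability"
begin

definition rademacher :: "'a measure \<Rightarrow> ('a \<Rightarrow> real) \<Rightarrow> bool" where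
  "rademacher M X \<longleftrightarrow>
     X \<in> borel_measurable M \<and>
     \<P>(\<omega> in M. X \<omega> = 1) = 1 / 2 \<and>
     \<P>(\<omega> in M. X \<omega> = - 1) = 1 / 2"

definition standard_gaussian :: "'a measure \<Rightarrow> ('a \<Rightarrow> real) \<Rightarrow> bool" where
  "standard_gaussian M X \<longleftrightarrow> distributed M lborel X (\<lambda>x. ennreal (std_normal_density x))"

end

theory Submission
  imports Defs
begin

text \<open>
  Only one-dimensional marginals are used. After an isometry the vectors are complex numbers;
  rescale them so that the standard deviation \<open>p(\<theta>)\<close> of the marginal of the Gaussian sum \<open>G\<close>
  in direction \<open>cis \<theta>\<close> has maximum \<open>1\<close>. For \<open>t < 3\<close> the direction of maximal deviation alone
  gives \<open>P(\<bar>G\<bar> \<ge> t) \<ge> 1/3824\<close>.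

  For \<open>t \<ge> 3\<close> both tails are compared with \<open>J = \<integral> exp(-t\<^sup>2/(2 p(\<theta>)\<^sup>2)) d\<theta>\<close>.
  From above, the function
  \<open>x \<mapsto> \<integral> p(\<theta>)\<^sup>-\<^sup>7 max(0, x \<bullet> cis \<theta> - u(\<theta>))\<^sup>3 d\<theta>\<close> with \<open>u(\<theta>) = t - 2 p(\<theta>)\<^sup>2/t\<close> is at least a
  multiple of \<open>t\<^sup>-\<^sup>4\<close> on \<open>\<bar>x\<bar> \<ge> t\<close> (directions within \<open>p/(4t)\<close> of \<open>x\<close> suffice), and by Pinelis'
  comparison of cubic moments its expectation at the Rademacher sum is at most its expectation at
  \<open>G\<close>, which is at most a multiple of \<open>t\<^sup>-\<^sup>4 J\<close>.
  From below, \<open>x \<mapsto> \<integral> (t/p(\<theta>)) 1{t \<le> x \<bullet> cis \<theta> \<le> t + p(\<theta>)\<^sup>2/(4t)} d\<theta>\<close> is bounded and vanishes for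
  \<open>\<bar>x\<bar> < t\<close>, while its expectation at \<open>G\<close> is at least a multiple of \<open>J\<close>.
  These bounds use only that \<open>0 < p \<le> 1\<close> and that \<open>p\<close> is 1-Lipschitz in the angle.
\<close>

subsection \<open>Comparison of cubic moments\<close>

text \<open>The left-hand side is the tangent at \<open>a\<^sup>2\<close> to the right-hand side as a function of \<open>s\<^sup>2\<close>.\<close>

lemma cube_above_tangent:
  fixes a b s :: real
  assumes "0 \<le> b" "b < a" "0 \<le> s"
  shows "(a - b)^3 + 3 * (a - b)\<^sup>2 / (2 * a) * (s\<^sup>2 - a\<^sup>2) \<le> max 0 (s - b) ^ 3"
proof -
  define d where "d = a - b"
  have d: "0 < d" "d \<le> a" "0 < a" "b = a - d" using assms by (auto simp: d_def)
  \<comment> \<open>Since \<open>d \<le> a\<close>, the second factor of the factorization below is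
    at least \<open>e + d / 2\<close>.\<close>
  have dd: "3 * d\<^sup>2 / (2 * a) \<le> 3/2 * d" 
    using d by (simp add: field_simps power2_eq_square)
  show ?thesis
  proof (cases "b \<le> s")
    case True
    define e where "e = s - b"
    have e: "0 \<le> e" "s = a - d + e" using True d by (auto simp: e_def)
    \<comment> \<open>The difference has a double zero at \<open>e = d\<close>, that is at
      \<open>s = a\<close>, the point of tangency.\<close>
    have "e^3 - d^3 - 3 * d\<^sup>2 / (2 * a) * (s\<^sup>2 - a\<^sup>2) = (e - d)\<^sup>2 * (e + 2 * d - 3 * d\<^sup>2 / (2 * a))"
      using d unfolding e(2) by (simp add: field_simps power2_eq_square power3_eq_cube)
    also have "\<dots> \<ge> 0" using dd d e by (intro mult_nonneg_nonneg) auto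
    finally show ?thesis using True by (simp add: d_def e_def)
  next
    case False
    \<comment> \<open>Here the positive part vanishes and the tangent increases with
      \<open>s^2\<close>, so it suffices to find it nonpositive at \<open>s = b\<close>.\<close>
    have "s\<^sup>2 \<le> b\<^sup>2" using False assms by (intro power_mono) auto
    then have "3 * d\<^sup>2 / (2 * a) * (s\<^sup>2 - a\<^sup>2) \<le> 3 * d\<^sup>2 / (2 * a) * (b\<^sup>2 - a\<^sup>2)"
      using d by (intro mult_left_mono) auto
    also have "\<dots> = - 3 * d^3 + 3/2 * d^4 / a"
      using d(3) unfolding d(4) by (simp add: field_simps power2_eq_square power3_eq_cube power4_eq_xxxx)
    also have "3/2 * d^4 / a \<le> 3/2 * d^3"
      using d by (simp add: field_simps power3_eq_cube power4_eq_xxxx)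
    finally have "d^3 + 3 * d\<^sup>2 / (2 * a) * (s\<^sup>2 - a\<^sup>2) \<le> - (d^3 / 2)" by simp
    also have "\<dots> \<le> 0" using d by simp
    finally show ?thesis using False by (simp add: d_def)
  qed
qed

text \<open>For \<open>x \<ge> 0\<close> the odd powers of \<open>s\<close> cancel as long as
  \<open>s \<le> x\<close>; beyond that, the truncated cube \<open>(x - s)^3\<close> is made up for
  by \<open>(s - x)^3\<close>. For \<open>x < 0\<close> only the first cube can be nonzero. This
  separates a part affine in \<open>s^2\<close> from one to which the tangent inequality
  applies.\<close>

lemma symmetrized_cube:
  fixes x s :: real
  assumes "0 \<le> s"
  shows "max 0 (x + s) ^ 3 + max 0 (x - s) ^ 3
    = (if 0 \<le> x then 2 * x^3 + 6 * x * s\<^sup>2 else 0) + max 0 (s - \<bar>x\<bar>) ^ 3"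
  using assms by (auto simp: max_def power2_eq_square power3_eq_cube algebra_simps)

text \<open>The number \<open>c\<close> is the slope of a supporting line at \<open>a^2\<close>: as
  a function of \<open>s^2\<close> the symmetrized cube is convex. In this form Jensen's inequality
  can be applied to a variable with second moment \<open>a^2\<close>.\<close>

lemma symmetrized_cube_convex_in_square:
  fixes x a :: real
  obtains c where "0 \<le> c" "\<And>s. max 0 (x + a) ^ 3 + max 0 (x - a) ^ 3 + c * (s\<^sup>2 - a\<^sup>2)
      \<le> max 0 (x + s) ^ 3 + max 0 (x - s) ^ 3"
proof -
  define k where "k s = max 0 (x + s) ^ 3 + max 0 (x - s) ^ 3" for s
  have even: "k s = k \<bar>s\<bar>" for s
    by (auto simp: k_def abs_if)
  have *: "k s = (if 0 \<le> x then 2 * x^3 + 6 * x * s\<^sup>2 else 0) + max 0 (\<bar>s\<bar> - \<bar>x\<bar>) ^ 3" for s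
    unfolding even[of s] using symmetrized_cube[of "\<bar>s\<bar>" x] by (simp add: k_def)
  have "\<exists>c\<ge>0. \<forall>s. max 0 (\<bar>a\<bar> - \<bar>x\<bar>) ^ 3 + c * (s\<^sup>2 - a\<^sup>2) \<le> max 0 (\<bar>s\<bar> - \<bar>x\<bar>) ^ 3"
  proof (cases "\<bar>x\<bar> < \<bar>a\<bar>")
    case True
    then show ?thesis using cube_above_tangent[of "\<bar>x\<bar>" "\<bar>a\<bar>"]
      by (intro exI[of _ "3 * (\<bar>a\<bar> - \<bar>x\<bar>)\<^sup>2 / (2 * \<bar>a\<bar>)"]) (auto, metis abs_ge_zero power2_abs)
  \<comment> \<open>If \<open>\<bar>a\<bar> \<le> \<bar>x\<bar>\<close>, the positive part vanishes
    at \<open>a\<close>, its minimum, so slope 0 works.\<close>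
  qed (auto intro!: exI[of _ 0])
  then obtain c where c: "0 \<le> c" "\<And>s. max 0 (\<bar>a\<bar> - \<bar>x\<bar>) ^ 3 + c * (s\<^sup>2 - a\<^sup>2) \<le> max 0 (\<bar>s\<bar> - \<bar>x\<bar>) ^ 3"
    by blast
  show ?thesis
  proof (rule that)
    show "0 \<le> (if 0 \<le> x then 6 * x else 0) + c" using c(1) by simp
    fix s
    have "k a + ((if 0 \<le> x then 6 * x else 0) + c) * (s\<^sup>2 - a\<^sup>2) \<le> k s"
      using c(2)[of s] unfolding *[of s] *[of a] by (cases "0 \<le> x") (simp_all add: algebra_simps)
    then show "max 0 (x + a) ^ 3 + max 0 (x - a) ^ 3 + ((if 0 \<le> x then 6 * x else 0) + c) * (s\<^sup>2 - a\<^sup>2)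
      \<le> max 0 (x + s) ^ 3 + max 0 (x - s) ^ 3" by (simp add: k_def)
  qed
qed

section \<open>Expectations of functions of independent sums\<close>

lemma (in prob_space) nn_integral_rademacher:
  assumes "rademacher M X"
  shows "(\<integral>\<^sup>+\<omega>. f (X \<omega>) \<partial>M) = (f 1 + f (-1)) / (2::ennreal)"
proof -
  have [measurable]: "X \<in> borel_measurable M" and p: "prob {\<omega>\<in>space M. X \<omega> = 1} = 1/2" "prob {\<omega>\<in>space M. X \<omega> = -1} = 1/2"
    using assms by (auto simp: rademacher_def)
  let ?A = "{\<omega>\<in>space M. X \<omega> = 1}" and ?B = "{\<omega>\<in>space M. X \<omega> = -1}"
  have "prob (?A \<union> ?B) = prob ?A + prob ?B"
    by (rule finite_measure_Union) auto
  then have "prob (?A \<union> ?B) = 1" using p by simp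
  then have "AE \<omega> in M. \<omega> \<in> ?A \<union> ?B"
    by (subst (asm) prob_eq_1) auto
  then have "(\<integral>\<^sup>+\<omega>. f (X \<omega>) \<partial>M) = (\<integral>\<^sup>+\<omega>. f 1 * indicator ?A \<omega> + f (-1) * indicator ?B \<omega> \<partial>M)"
    by (intro nn_integral_cong_AE) (auto elim!: eventually_mono simp: indicator_def)
  also have "\<dots> = f 1 * ennreal (1/2) + f (-1) * ennreal (1/2)"
  proof -
    have "emeasure M ?A = ennreal (1/2)" "emeasure M ?B = ennreal (1/2)"
      using p by (simp_all only: emeasure_eq_measure)
    then show ?thesis by (subst nn_integral_add) (simp_all add: nn_integral_cmult)
  qed
  also have "ennreal (1/2) = 1/2"
    using divide_ennreal[of 1 2] by simp
  finally show ?thesis by (simp add: ennreal_times_divide add_divide_distrib_ennreal)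
qed

text \<open>Independence makes the joint law a product, so Tonelli averages the two summands
  separately, as if each lived on its own copy of the space.\<close>

lemma (in prob_space) nn_integral_indep_add:
  fixes X Y :: "'a \<Rightarrow> real" and h :: "real \<Rightarrow> ennreal"
  assumes "indep_var borel X borel Y" and [measurable]: "h \<in> borel_measurable borel"
  shows "(\<integral>\<^sup>+\<omega>. h (X \<omega> + Y \<omega>) \<partial>M) = (\<integral>\<^sup>+\<omega>'. \<integral>\<^sup>+\<omega>. h (X \<omega> + Y \<omega>') \<partial>M \<partial>M)"
proof -
  have [measurable]: "random_variable borel X" "random_variable borel Y" and
    d: "distr M borel X \<Otimes>\<^sub>M distr M borel Y = distr M (borel \<Otimes>\<^sub>M borel) (\<lambda>\<omega>. (X \<omega>, Y \<omega>))"
    using assms(1) by (auto simp: indep_var_distribution_eq)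
  interpret X: prob_space "distr M borel X" by (rule prob_space_distr) auto
  interpret Y: prob_space "distr M borel Y" by (rule prob_space_distr) auto
  interpret P: pair_sigma_finite "distr M borel X" "distr M borel Y" ..
  have "(\<integral>\<^sup>+\<omega>. h (X \<omega> + Y \<omega>) \<partial>M) = (\<integral>\<^sup>+z. h (fst z + snd z) \<partial>distr M (borel \<Otimes>\<^sub>M borel) (\<lambda>\<omega>. (X \<omega>, Y \<omega>)))"
    by (subst nn_integral_distr) auto
  also have "\<dots> = (\<integral>\<^sup>+y. \<integral>\<^sup>+x. h (x + y) \<partial>distr M borel X \<partial>distr M borel Y)"
    unfolding d[symmetric] by (subst P.nn_integral_snd[symmetric]) auto
  also have "\<dots> = (\<integral>\<^sup>+\<omega>'. \<integral>\<^sup>+\<omega>. h (X \<omega> + Y \<omega>') \<partial>M \<partial>M)"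
    by (subst nn_integral_distr) (auto simp: nn_integral_distr)
  finally show ?thesis .
qed

text \<open>The summands are exchanged one at a time; as \<open>x\<close> is arbitrary, conditioning on the others
  reduces each exchange to the hypothesis.\<close>

lemma nn_integral_sum_indep_mono:
  fixes X :: "'i \<Rightarrow> 'a \<Rightarrow> real" and Y :: "'i \<Rightarrow> 'b \<Rightarrow> real" and h :: "real \<Rightarrow> ennreal"
  assumes M: "prob_space M" and N: "prob_space N" and "finite I"
    and "prob_space.indep_vars M (\<lambda>_. borel) X I" "prob_space.indep_vars N (\<lambda>_. borel) Y I"
    and [measurable]: "h \<in> borel_measurable borel"
    and "\<And>i x. i \<in> I \<Longrightarrow> (\<integral>\<^sup>+\<omega>. h (x + X i \<omega>) \<partial>M) \<le> (\<integral>\<^sup>+\<omega>. h (x + Y i \<omega>) \<partial>N)"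
  shows "(\<integral>\<^sup>+\<omega>. h (x + (\<Sum>i\<in>I. X i \<omega>)) \<partial>M) \<le> (\<integral>\<^sup>+\<omega>. h (x + (\<Sum>i\<in>I. Y i \<omega>)) \<partial>N)"
proof -
  interpret M: prob_space M by fact
  interpret N: prob_space N by fact
  interpret MN: pair_sigma_finite M N ..
  show ?thesis using assms(3-5,7)
  proof (induction I arbitrary: x)
    case empty
    then show ?case by (simp add: M.emeasure_space_1 N.emeasure_space_1)
  next
    case (insert j I)
    have IH: "(\<integral>\<^sup>+\<omega>. h (x + (\<Sum>i\<in>I. X i \<omega>)) \<partial>M) \<le> (\<integral>\<^sup>+\<omega>. h (x + (\<Sum>i\<in>I. Y i \<omega>)) \<partial>N)" for x
      using insert.prems
      by (intro insert.IH) (auto intro: M.indep_vars_subset N.indep_vars_subset)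
    have iX: "M.indep_var borel (X j) borel (\<lambda>\<omega>. \<Sum>i\<in>I. X i \<omega>)"
      using insert by (intro M.indep_vars_sum) auto
    have iY: "N.indep_var borel (Y j) borel (\<lambda>\<omega>. \<Sum>i\<in>I. Y i \<omega>)"
      using insert by (intro N.indep_vars_sum) auto
    have [measurable]: "X j \<in> borel_measurable M" "Y j \<in> borel_measurable N"
       "(\<lambda>\<omega>. \<Sum>i\<in>I. X i \<omega>) \<in> borel_measurable M" "(\<lambda>\<omega>. \<Sum>i\<in>I. Y i \<omega>) \<in> borel_measurable N"
      using M.indep_var_rv1[OF iX] M.indep_var_rv2[OF iX] N.indep_var_rv1[OF iY] N.indep_var_rv2[OF iY] by auto
    have "(\<integral>\<^sup>+\<omega>. h (x + (\<Sum>i\<in>insert j I. X i \<omega>)) \<partial>M)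
        = (\<integral>\<^sup>+\<omega>. h (x + (X j \<omega> + (\<Sum>i\<in>I. X i \<omega>))) \<partial>M)"
      using insert.hyps by simp
    also have "\<dots> = (\<integral>\<^sup>+\<omega>'. \<integral>\<^sup>+\<omega>. h (x + (X j \<omega> + (\<Sum>i\<in>I. X i \<omega>'))) \<partial>M \<partial>M)"
      by (rule M.nn_integral_indep_add[OF iX, of "\<lambda>y. h (x + y)"]) auto
    also have "\<dots> = (\<integral>\<^sup>+\<omega>'. \<integral>\<^sup>+\<omega>. h ((x + (\<Sum>i\<in>I. X i \<omega>')) + X j \<omega>) \<partial>M \<partial>M)"
      by (simp add: ac_simps)
    also have "\<dots> \<le> (\<integral>\<^sup>+\<omega>'. \<integral>\<^sup>+\<omega>. h ((x + (\<Sum>i\<in>I. X i \<omega>')) + Y j \<omega>) \<partial>N \<partial>M)"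
      using insert.prems by (intro nn_integral_mono) auto
    \<comment> \<open>The swap makes the sum over \<open>I\<close> the inner variable, so that the
      induction hypothesis applies with base point \<open>x + Y j \<omega>\<close>.\<close>
    also have "\<dots> = (\<integral>\<^sup>+\<omega>. \<integral>\<^sup>+\<omega>'. h ((x + (\<Sum>i\<in>I. X i \<omega>')) + Y j \<omega>) \<partial>M \<partial>N)"
      by (rule MN.Fubini'[symmetric]) measurable
    also have "\<dots> = (\<integral>\<^sup>+\<omega>. \<integral>\<^sup>+\<omega>'. h ((x + Y j \<omega>) + (\<Sum>i\<in>I. X i \<omega>')) \<partial>M \<partial>N)"
      by (simp add: ac_simps)
    also have "\<dots> \<le> (\<integral>\<^sup>+\<omega>. \<integral>\<^sup>+\<omega>'. h ((x + Y j \<omega>) + (\<Sum>i\<in>I. Y i \<omega>')) \<partial>N \<partial>N)"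
      by (intro nn_integral_mono IH)
    also have "\<dots> = (\<integral>\<^sup>+\<omega>'. \<integral>\<^sup>+\<omega>. h ((x + Y j \<omega>) + (\<Sum>i\<in>I. Y i \<omega>')) \<partial>N \<partial>N)"
    proof -
      interpret NN: pair_sigma_finite N N ..
      show ?thesis by (rule NN.Fubini') measurable
    qed
    also have "\<dots> = (\<integral>\<^sup>+\<omega>'. \<integral>\<^sup>+\<omega>. h (x + (Y j \<omega> + (\<Sum>i\<in>I. Y i \<omega>'))) \<partial>N \<partial>N)"
      by (simp add: ac_simps)
    also have "\<dots> = (\<integral>\<^sup>+\<omega>. h (x + (Y j \<omega> + (\<Sum>i\<in>I. Y i \<omega>))) \<partial>N)"
      by (rule N.nn_integral_indep_add[OF iY, of "\<lambda>y. h (x + y)", symmetric]) auto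
    finally show ?case using insert.hyps by simp
  qed
qed

text \<open>Averaging over the sign gives \<open>k a / 2\<close> on the left and, by symmetry of
  \<open>Y\<close>, the mean of \<open>k (a * Y) / 2\<close> on the right. Since \<open>k\<close> is
  convex in the square and \<open>(a * Y)^2\<close> has mean \<open>a^2\<close>, Jensen's inequality
  gives the comparison.\<close>

lemma rademacher_cube_le_gaussian_cube:
  fixes a x :: real
  assumes "prob_space M" "rademacher M X" and Y: "standard_gaussian N Y"
  shows "(\<integral>\<^sup>+\<omega>. ennreal (max 0 (x + a * X \<omega>) ^ 3) \<partial>M) \<le> (\<integral>\<^sup>+\<omega>. ennreal (max 0 (x + a * Y \<omega>) ^ 3) \<partial>N)"
proof -
  interpret M: prob_space M by fact
  let ?g = "std_normal_density"
  define k where "k s = max 0 (x + s) ^ 3 + max 0 (x - s) ^ 3" for s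
  have k0: "0 \<le> k s" for s by (simp add: k_def)
  obtain c where c: "0 \<le> c" "\<And>s. k a + c * (s\<^sup>2 - a\<^sup>2) \<le> k s"
    using symmetrized_cube_convex_in_square[of x a] unfolding k_def by metis
  let ?I = "\<integral>\<^sup>+y. ennreal (?g y * max 0 (x + a * y) ^ 3) \<partial>lborel"
  have lhs: "(\<integral>\<^sup>+\<omega>. ennreal (max 0 (x + a * X \<omega>) ^ 3) \<partial>M) = ennreal (k a) / 2"
    using M.nn_integral_rademacher[OF assms(2), of "\<lambda>r. ennreal (max 0 (x + a * r) ^ 3)"] 
    by (simp add: k_def ennreal_plus[symmetric] del: ennreal_plus)
  have rhs: "(\<integral>\<^sup>+\<omega>. ennreal (max 0 (x + a * Y \<omega>) ^ 3) \<partial>N) = ?I"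
    using distributed_nn_integral[OF Y[unfolded standard_gaussian_def], of "\<lambda>y. ennreal (max 0 (x + a * y) ^ 3)"]
    by (simp add: ennreal_mult)
  have refl: "?I = (\<integral>\<^sup>+y. ennreal (?g y * max 0 (x - a * y) ^ 3) \<partial>lborel)"
    by (subst nn_integral_real_affine[where c="-1" and t=0])
      (auto simp: std_normal_density_def)
  \<comment> \<open>The term \<open>c * a^2\<close> is added on both sides to keep all integrands
    nonnegative; being finite, it cancels at the end.\<close>
  have "ennreal (k a) + ennreal (c * a\<^sup>2) = ennreal (k a + c * a\<^sup>2)"
    using k0 c by (simp add: ennreal_plus)
  also have "\<dots> = (\<integral>\<^sup>+y. ennreal (?g y * (k a + c * (a * y)\<^sup>2)) \<partial>lborel)"
  proof -
    have "has_bochner_integral lborel (\<lambda>y. k a * ?g y + c * a\<^sup>2 * (?g y * y\<^sup>2)) (k a * 1 + c * a\<^sup>2 * 1)"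
      using std_normal_moment_even[of 0] std_normal_moment_even[of 1]
      by (intro has_bochner_integral_add has_bochner_integral_mult_right) (auto simp: fact_numeral)
    then have "has_bochner_integral lborel (\<lambda>y. ?g y * (k a + c * (a * y)\<^sup>2)) (k a + c * a\<^sup>2)"
      by (simp add: algebra_simps power2_eq_square)
    then show ?thesis
      using k0 c by (subst nn_integral_eq_integral) (auto simp: has_bochner_integral_iff)
  qed
  also have "\<dots> \<le> (\<integral>\<^sup>+y. ennreal (?g y * (k (a * y) + c * a\<^sup>2)) \<partial>lborel)"
  proof (intro nn_integral_mono ennreal_leI mult_left_mono)
    show "k a + c * (a * y)\<^sup>2 \<le> k (a * y) + c * a\<^sup>2" for y
      using c(2)[of "a * y"] by (simp add: algebra_simps)
  qed simp
  also have "\<dots> = (\<integral>\<^sup>+y. ennreal (?g y * max 0 (x + a * y) ^ 3) + ennreal (?g y * max 0 (x - a * y) ^ 3)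
       + ennreal (c * a\<^sup>2) * ennreal (?g y) \<partial>lborel)"
    using c(1) by (intro nn_integral_cong) (simp add: k_def algebra_simps flip: ennreal_plus ennreal_mult)
  also have "\<dots> = ?I + ?I + ennreal (c * a\<^sup>2)"
  proof -
    have "(\<integral>\<^sup>+y. ennreal (?g y) \<partial>lborel) = 1"
      using prob_space_normal_density[of 1 0] by (simp add: prob_space.emeasure_space_1 emeasure_density prob_space_def prob_space_axioms_def std_normal_density_def)
    then show ?thesis
      by (subst nn_integral_add, simp, simp, subst nn_integral_add) (simp_all add: nn_integral_cmult refl[symmetric])
  qed
  finally have "ennreal (k a) \<le> 2 * ?I" by (simp add: mult_2)
  then have "ennreal (k a) / 2 \<le> ?I"
    by (intro divide_le_posI_ennreal) (auto simp: mult.commute)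
  then show ?thesis unfolding lhs rhs .
qed

subsection \<open>Gaussian marginals\<close>

lemma distributed_gaussian_combination:
  assumes "prob_space N" "finite I" "prob_space.indep_vars N (\<lambda>_. borel) g I"
    and g: "\<And>i. i \<in> I \<Longrightarrow> standard_gaussian N (g i)" and pos: "0 < L2_set a I"
  shows "distributed N lborel (\<lambda>\<omega>. \<Sum>i\<in>I. a i * g i \<omega>) (normal_density 0 (L2_set a I))"
proof -
  interpret prob_space N by fact
  \<comment> \<open>A zero coefficient gives a summand without a density. Such summands are dropped,
    and \<open>pos\<close> leaves at least one.\<close>
  let ?J = "{i\<in>I. a i \<noteq> 0}"
  have sq: "(\<Sum>i\<in>?J. (a i)\<^sup>2) = (\<Sum>i\<in>I. (a i)\<^sup>2)"
    using \<open>finite I\<close> by (intro sum.mono_neutral_left) auto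
  have "?J \<noteq> {}"
  proof
    assume "?J = {}"
    with sq pos show False by (simp add: L2_set_def)
  qed
  moreover have "indep_vars (\<lambda>_. borel) (\<lambda>i \<omega>. a i * g i \<omega>) ?J"
    by (rule indep_vars_compose2[where Y="\<lambda>i x. a i * x", OF indep_vars_subset[OF assms(3)]]) auto
  moreover have "distributed N lborel (\<lambda>\<omega>. a i * g i \<omega>) (normal_density 0 \<bar>a i\<bar>)" if "i \<in> ?J" for i
    using normal_density_affine[of "g i" 0 1 "a i" 0] g[of i] that
    by (simp add: standard_gaussian_def)
  ultimately have "distributed N lborel (\<lambda>\<omega>. \<Sum>i\<in>?J. a i * g i \<omega>)
      (normal_density (\<Sum>i\<in>?J. 0) (sqrt (\<Sum>i\<in>?J. \<bar>a i\<bar>\<^sup>2)))"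
    using \<open>finite I\<close> by (intro sum_indep_normal) auto
  moreover have "(\<Sum>i\<in>?J. a i * g i \<omega>) = (\<Sum>i\<in>I. a i * g i \<omega>)" for \<omega>
    using \<open>finite I\<close> by (intro sum.mono_neutral_left) auto
  ultimately show ?thesis by (simp add: sq L2_set_def)
qed

text \<open>Dropping the term quadratic in \<open>z\<close> bounds the density at
  \<open>u + z\<close> by its value at \<open>u\<close> times \<open>exp (- l * z)\<close>.
  Integrating \<open>z^3\<close> against this exponential gives \<open>6 / l^4\<close>, because
  \<open>erlang_density 3 l\<close> has total mass 1.\<close>

lemma nn_integral_normal_cube_le:
  assumes D: "distributed N lborel Y (normal_density 0 \<sigma>)" and "0 < \<sigma>" "0 < u"
  shows "(\<integral>\<^sup>+\<omega>. ennreal (max 0 (Y \<omega> - u) ^ 3) \<partial>N)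
     \<le> ennreal (6 * \<sigma>^7 / u^4 * exp (- u\<^sup>2 / (2 * \<sigma>\<^sup>2)) / sqrt (2 * pi))"
proof -
  define l where "l = u / \<sigma>\<^sup>2"
  define C where "C = exp (- u\<^sup>2 / (2 * \<sigma>\<^sup>2)) / (sqrt (2 * pi) * \<sigma>) * 6 / l^4"
  have l: "0 < l" and C: "0 \<le> C" using assms by (auto simp: l_def C_def)
  have "(\<integral>\<^sup>+\<omega>. ennreal (max 0 (Y \<omega> - u) ^ 3) \<partial>N)
      = (\<integral>\<^sup>+y. ennreal (normal_density 0 \<sigma> y) * ennreal (max 0 (y - u) ^ 3) \<partial>lborel)"
    using distributed_nn_integral[OF D, of "\<lambda>y. ennreal (max 0 (y - u) ^ 3)"] by simp
  also have "\<dots> = (\<integral>\<^sup>+z. ennreal (normal_density 0 \<sigma> (u + z)) * ennreal (max 0 z ^ 3) \<partial>lborel)"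
    by (subst nn_integral_real_affine[where c=1 and t=u]) auto
  also have "\<dots> \<le> (\<integral>\<^sup>+z. ennreal C * ennreal (erlang_density 3 l z) \<partial>lborel)"
  proof (intro nn_integral_mono)
    fix z :: real
    show "ennreal (normal_density 0 \<sigma> (u + z)) * ennreal (max 0 z ^ 3) \<le> ennreal C * ennreal (erlang_density 3 l z)"
    proof (cases "z < 0")
      case False
      have "- (u + z)\<^sup>2 / (2 * \<sigma>\<^sup>2) \<le> - u\<^sup>2 / (2 * \<sigma>\<^sup>2) + - l * z"
        using assms(2) by (simp add: l_def field_simps power2_eq_square)
      then have "exp (- (u + z)\<^sup>2 / (2 * \<sigma>\<^sup>2)) \<le> exp (- u\<^sup>2 / (2 * \<sigma>\<^sup>2)) * exp (- l * z)"
        by (simp flip: exp_add)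
      then have "exp (- (u + z)\<^sup>2 / (2 * \<sigma>\<^sup>2)) / (sqrt (2 * pi) * \<sigma>) * z^3
         \<le> exp (- u\<^sup>2 / (2 * \<sigma>\<^sup>2)) * exp (- l * z) / (sqrt (2 * pi) * \<sigma>) * z^3"
        using False assms(2) by (intro mult_right_mono divide_right_mono) auto
      also have "\<dots> = C * erlang_density 3 l z"
        using False l assms(2) by (simp add: C_def erlang_density_def fact_numeral field_simps eval_nat_numeral)
      finally show ?thesis
        using False C l assms(2)
        by (subst (1 2) ennreal_mult[symmetric]) (auto simp: normal_density_def real_sqrt_mult)
    qed simp
  qed
  also have "\<dots> = ennreal C"
    using prob_space.emeasure_space_1[OF prob_space_erlang_density[OF l, of 3]]
    by (simp add: nn_integral_cmult emeasure_density)
  also have "C = 6 * \<sigma>^7 / u^4 * exp (- u\<^sup>2 / (2 * \<sigma>\<^sup>2)) / sqrt (2 * pi)"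
    using assms(2,3) by (simp add: C_def l_def field_simps eval_nat_numeral)
  finally show ?thesis .
qed

text \<open>As \<open>l \<ge> 0\<close>, the density is smallest at the right endpoint.\<close>

lemma normal_interval_ge:
  assumes D: "distributed N lborel Y (normal_density 0 \<sigma>)" and "0 < \<sigma>" "0 \<le> l" "0 \<le> w"
  shows "ennreal (w / \<sigma> * exp (- (l + w)\<^sup>2 / (2 * \<sigma>\<^sup>2)) / sqrt (2 * pi))
     \<le> emeasure N {\<omega>\<in>space N. l \<le> Y \<omega> \<and> Y \<omega> \<le> l + w}"
proof -
  define c where "c = exp (- (l + w)\<^sup>2 / (2 * \<sigma>\<^sup>2)) / (sqrt (2 * pi) * \<sigma>)"
  have "ennreal (w / \<sigma> * exp (- (l + w)\<^sup>2 / (2 * \<sigma>\<^sup>2)) / sqrt (2 * pi)) = ennreal c * ennreal w"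
    using assms by (simp add: c_def field_simps flip: ennreal_mult)
  also have "\<dots> = (\<integral>\<^sup>+y. ennreal c * indicator {l..l+w} y \<partial>lborel)"
    using assms by (simp add: nn_integral_cmult)
  also have "\<dots> \<le> (\<integral>\<^sup>+y. ennreal (normal_density 0 \<sigma> y) * indicator {l..l+w} y \<partial>lborel)"
  proof (intro nn_integral_mono)
    fix y
    have "ennreal c \<le> ennreal (normal_density 0 \<sigma> y)" if "y \<in> {l..l+w}"
    proof (rule ennreal_leI)
      have "y\<^sup>2 \<le> (l + w)\<^sup>2" using that assms by (intro power_mono) auto
      then show "c \<le> normal_density 0 \<sigma> y"
        using assms by (auto simp: c_def normal_density_def real_sqrt_mult intro!: divide_right_mono)
    qed
    then show "ennreal c * indicator {l..l+w} y \<le> ennreal (normal_density 0 \<sigma> y) * indicator {l..l+w} y"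
      by (auto simp: indicator_def)
  qed
  also have "\<dots> = emeasure N (Y -` {l..l+w} \<inter> space N)"
    by (rule distributed_emeasure[OF D, symmetric]) auto
  also have "Y -` {l..l+w} \<inter> space N = {\<omega>\<in>space N. l \<le> Y \<omega> \<and> Y \<omega> \<le> l + w}" by auto
  finally show ?thesis .
qed

subsection \<open>Averages over directions\<close>

text \<open>The difference is \<open>2 * sin ((a + b) / 2) * sin y\<close> with
  \<open>y = (b - a) / 2\<close>, and \<open>a \<ge> 0\<close> makes both sines at least
  \<open>sin y\<close>. As \<open>y \<le> pi / 4 < 4/5\<close>, Taylor expansion gives
  \<open>sin y \<ge> 13/15 * y\<close>, and \<open>2 * (13/15)^2 \<ge> 3/2\<close>.\<close>

lemma cos_diff_ge:
  fixes a b :: real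
  assumes "0 \<le> a" "a \<le> b" "b \<le> pi / 2"
  shows "3/8 * (b - a)\<^sup>2 \<le> cos a - cos b"
proof -
  define y where "y = (b - a) / 2"
  have y: "0 \<le> y" "y \<le> (a + b) / 2" "(a + b) / 2 \<le> pi / 2" "y \<le> 4/5"
    using assms pi_less_4 pi_approx by (auto simp: y_def)
  have "\<bar>sin y - (\<Sum>m<4. sin_coeff m * y ^ m)\<bar> \<le> inverse (fact 4) * \<bar>y\<bar> ^ 4"
    by (rule Maclaurin_sin_bound)
  then have "\<bar>sin y - (y - y^3 / 6)\<bar> * 24 \<le> y^4"
    using y(1) by (simp add: sin_coeff_def lessThan_nat_numeral fact_numeral)
  then have "- (sin y - (y - y^3 / 6)) \<le> y^4 / 24"
    by (intro order_trans[OF abs_ge_minus_self]) simp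
  then have "y - y^3 / 6 - y^4 / 24 \<le> sin y" by simp
  moreover have "y * (13/15) \<le> y - y^3 / 6 - y^4 / 24"
  proof -
    have "y^2 \<le> (4/5)^2" "y^3 \<le> (4/5)^3" using y by (intro power_mono; simp)+
    then have "0 \<le> y * (1 - y^2 / 6 - y^3 / 24 - 13/15)"
      using y(1) by (intro mult_nonneg_nonneg) (auto simp: power2_eq_square power3_eq_cube)
    then show ?thesis by (simp add: algebra_simps eval_nat_numeral)
  qed
  ultimately have s: "13/15 * y \<le> sin y" by simp
  have s': "sin y \<le> sin ((a + b) / 2)" using y by (intro sin_monotone_2pi_le) auto
  have "3/8 * (b - a)\<^sup>2 = 3/2 * y\<^sup>2" by (simp add: y_def power2_eq_square field_simps)
  also have "\<dots> \<le> 2 * ((13/15 * y) * (13/15 * y))" by (simp add: power2_eq_square)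
  also have "\<dots> \<le> 2 * (sin ((a + b) / 2) * sin y)"
    using s s' y(1) by (intro mult_left_mono mult_mono) auto
  also have "\<dots> = cos a - cos b" by (simp add: cos_diff_cos y_def)
  finally show ?thesis .
qed

lemma emeasure_lborel_le_diameter:
  fixes A :: "real set"
  assumes "\<And>x y. x \<in> A \<Longrightarrow> y \<in> A \<Longrightarrow> \<bar>x - y\<bar> \<le> D" "0 \<le> D"
  shows "emeasure lborel A \<le> ennreal D"
proof (cases "A = {}")
  case False
  then obtain z where z: "z \<in> A" by auto
  have "bdd_below A" by (rule bdd_belowI[of _ "z - D"]) (use assms(1)[OF z] in \<open>force simp: abs_le_iff\<close>)
  moreover have "x - D \<le> Inf A" if "x \<in> A" for x
    using False assms(1)[OF that] by (intro cInf_greatest) (force simp: abs_le_iff)+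
  ultimately have "A \<subseteq> {Inf A .. Inf A + D}"
    by (force intro: cInf_lower)
  then have "emeasure lborel A \<le> emeasure lborel {Inf A .. Inf A + D}"
    by (intro emeasure_mono) auto
  then show ?thesis using assms(2) by simp
qed simp

text \<open>On a set this short, a 1-Lipschitz \<open>p\<close> varies at most by the factor
  \<open>1 / (1 - q)\<close>. With \<open>m\<close> its infimum, the integrand is at most
  \<open>1 / m\<close> and the set has length at most \<open>q * m / (1 - q)\<close>, so the scale
  \<open>m\<close> cancels.\<close>

lemma nn_integral_inverse_on_short_set:
  fixes p :: "real \<Rightarrow> real" and A :: "real set"
  assumes A: "A \<in> sets lborel" and p0: "\<And>x. 0 < p x"
    and lip: "\<And>x y. \<bar>p x - p y\<bar> \<le> \<bar>x - y\<bar>"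
    and short: "\<And>x y. x \<in> A \<Longrightarrow> y \<in> A \<Longrightarrow> \<bar>x - y\<bar> \<le> q * max (p x) (p y)"
    and q: "0 \<le> q" "q < 1"
  shows "(\<integral>\<^sup>+x. ennreal (1 / p x) * indicator A x \<partial>lborel) \<le> ennreal (q / (1 - q))"
proof (cases "A = {}")
  case False
  have comp: "(1 - q) * p x \<le> p y" if "x \<in> A" "y \<in> A" for x y
  proof (cases "p x \<le> p y")
    case True
    have "(1 - q) * p x \<le> 1 * p x" using q p0[of x] by (intro mult_right_mono) auto
    then show ?thesis using True by simp
  next
    case False
    then show ?thesis using short[OF that] lip[of x y] by (simp add: algebra_simps)
  qed
  define m where "m = Inf (p ` A)"
  have m1: "(1 - q) * p x \<le> m" if "x \<in> A" for x
    unfolding m_def using False comp[OF that] by (intro cInf_greatest) auto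
  have m2: "m \<le> p x" if "x \<in> A" for x
    unfolding m_def using that p0 by (intro cInf_lower bdd_belowI[of _ 0]) (auto intro: less_imp_le)
  have m0: "0 < m"
    using False m1 p0 q by (metis diff_gt_0_iff_gt ex_in_conv less_le_trans mult_pos_pos)
  have "\<bar>x - y\<bar> \<le> q * (m / (1 - q))" if "x \<in> A" "y \<in> A" for x y
  proof -
    have "max (p x) (p y) \<le> m / (1 - q)"
      using m1[OF that(1)] m1[OF that(2)] q by (simp add: field_simps)
    then have "q * max (p x) (p y) \<le> q * (m / (1 - q))" using q by (intro mult_left_mono) auto
    then show ?thesis using short[OF that] by linarith
  qed
  then have e: "emeasure lborel A \<le> ennreal (q * (m / (1 - q)))"
    using q m0 by (intro emeasure_lborel_le_diameter) auto
  have "(\<integral>\<^sup>+x. ennreal (1 / p x) * indicator A x \<partial>lborel) \<le> (\<integral>\<^sup>+x. ennreal (1 / m) * indicator A x \<partial>lborel)"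
    using m2 m0 by (intro nn_integral_mono) (auto simp: indicator_def intro!: ennreal_leI frac_le)
  also have "\<dots> = ennreal (1 / m) * emeasure lborel A"
    using A by (simp add: nn_integral_cmult_indicator)
  also have "\<dots> \<le> ennreal (1 / m) * ennreal (q * (m / (1 - q)))" by (intro mult_left_mono e) auto
  also have "\<dots> = ennreal (q / (1 - q))" using m0 q by (simp flip: ennreal_mult)
  finally show ?thesis .
qed simp

lemma inner_cis: "x \<bullet> cis \<theta> = cmod x * cos (\<theta> - Arg x)"
  by (subst rcis_cmod_Arg[of x, symmetric]) (simp add: rcis_def inner_complex_def cos_diff algebra_simps)

lemma cos_minus_2pi_int: "cos (a - 2 * pi * real_of_int k) = cos a"
  using cos_int_2pin[of k] sin_int_2pin[of k] by (simp only: cos_diff)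

text \<open>The bound on \<open>a\<close> covers the difference of an angle in
  \<open>[-4, 4]\<close> and an argument. As \<open>4 + pi + pi / 2 < 4 * pi\<close>, only three
  periods can occur.\<close>

lemma cos_pos_cases:
  fixes a :: real
  assumes "0 < cos a" "\<bar>a\<bar> \<le> 4 + pi"
  obtains k :: int where "k \<in> {-1, 0, 1}" "\<bar>a - 2 * pi * k\<bar> \<le> pi / 2"
proof -
  define k where "k = round (a / (2 * pi))"
  define y where "y = a - 2 * pi * k"
  have "\<bar>a / (2 * pi) - k\<bar> \<le> 1/2" unfolding k_def by (metis abs_minus_commute of_int_round_abs_le)
  then have "\<bar>y\<bar> \<le> pi" by (simp add: y_def abs_le_iff field_simps)
  moreover have "cos y = cos a" unfolding y_def by (rule cos_minus_2pi_int)
  moreover have "cos y \<le> 0" if "pi / 2 < \<bar>y\<bar>" "\<bar>y\<bar> \<le> pi"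
    using that cos_monotone_0_pi[of "pi/2" "\<bar>y\<bar>"] by simp
  ultimately have y: "\<bar>y\<bar> \<le> pi / 2" using assms(1) by linarith
  have "\<bar>2 * pi * k\<bar> \<le> \<bar>y\<bar> + \<bar>a\<bar>" by (simp add: y_def)
  also have "\<dots> < 2 * pi * 2" using y assms(2) pi_approx by simp
  finally have "\<bar>real_of_int k\<bar> < 2" by (simp add: abs_mult)
  then have "k \<in> {-1, 0, 1}" by auto
  with y that show ?thesis by (auto simp: y_def)
qed

text \<open>On a half arc, two angles of the window at distance \<open>D\<close> satisfy
  \<open>3/8 * t * D^2 \<le> m^2 / (4 * t)\<close>, where \<open>m\<close> is the larger value of
  \<open>p\<close>. So each of the six pieces has diameter at most a constant times
  \<open>m / t\<close>, and the integral of \<open>1 / p\<close> over it is of order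
  \<open>1 / t\<close>, whatever the size of \<open>p\<close>.\<close>

lemma window_integral_le:
  fixes p :: "real \<Rightarrow> real" and x :: complex
  assumes p0: "\<And>\<theta>. 0 < p \<theta>" and lip: "\<And>\<theta> \<theta>'. \<bar>p \<theta> - p \<theta>'\<bar> \<le> \<bar>\<theta> - \<theta>'\<bar>" and "3 \<le> t"
  shows "(\<integral>\<^sup>+\<theta>\<in>{-4..4}. ennreal (t / p \<theta>) * indicator {\<theta>. t \<le> x \<bullet> cis \<theta> \<and> x \<bullet> cis \<theta> \<le> t + (p \<theta>)\<^sup>2 / (4 * t)} \<theta> \<partial>lborel)
    \<le> ennreal (738/109)"
proof -
  have cont: "continuous_on UNIV p"
    by (rule lipschitz_on_continuous_on[of 1]) (simp add: lip lipschitz_on_def dist_real_def)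
  then have [measurable]: "p \<in> borel_measurable borel" by (rule borel_measurable_continuous_onI)
  define W where "W = {\<theta>. t \<le> x \<bullet> cis \<theta> \<and> x \<bullet> cis \<theta> \<le> t + (p \<theta>)\<^sup>2 / (4 * t)}"
  txt \<open>For \<open>\<theta>\<close> in \<open>[-4, 4]\<close> the angle to \<open>x\<close> meets at most three arcs of positive cosine, indexed by
    \<open>k\<close>; \<open>s\<close> selects the half arc, on which the cosine is monotone.\<close>
  define a where "a k s \<theta> = s * (\<theta> - Arg x - 2 * pi * real_of_int k)" for k s \<theta>
  define P where "P = (\<lambda>(k, s). {\<theta>\<in>W. 0 \<le> a k s \<theta> \<and> a k s \<theta> \<le> pi / 2})"
  define K where "K = {-1, 0, 1::int} \<times> {-1, 1::real}"
  have t: "0 < t" using assms by simp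
  have [measurable]: "W \<in> sets borel" unfolding W_def inner_cis by measurable
  have Pm: "P i \<in> sets borel" for i
    unfolding P_def a_def by (cases i) (simp, measurable)
  have cos_a: "cos (a k s \<theta>) = cos (\<theta> - Arg x)" if "s \<in> {-1, 1}" for k s \<theta>
  proof -
    have "cos (a k s \<theta>) = cos (\<theta> - Arg x - 2 * pi * real_of_int k)"
      using that cos_minus[of "\<theta> - Arg x - 2 * pi * real_of_int k"] by (auto simp: a_def)
    then show ?thesis by (simp add: cos_minus_2pi_int)
  qed
  have cover: "\<exists>i\<in>K. \<theta> \<in> P i" if \<theta>: "\<theta> \<in> W" "\<theta> \<in> {-4..4}" for \<theta>
  proof -
    have "0 < cmod x * cos (\<theta> - Arg x)" using \<theta>(1) t by (simp add: W_def inner_cis)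
    then have "0 < cos (\<theta> - Arg x)" by (simp add: zero_less_mult_iff)
    moreover have "\<bar>\<theta> - Arg x\<bar> \<le> 4 + pi" using \<theta>(2) Arg_bounded[of x] by auto
    ultimately obtain k where k: "k \<in> {-1, 0, 1}" "\<bar>\<theta> - Arg x - 2 * pi * real_of_int k\<bar> \<le> pi / 2"
      by (rule cos_pos_cases)
    define s where "s = (if 0 \<le> \<theta> - Arg x - 2 * pi * real_of_int k then 1 else -1::real)"
    have "a k s \<theta> = \<bar>\<theta> - Arg x - 2 * pi * real_of_int k\<bar>" by (simp add: a_def s_def)
    then have "\<theta> \<in> P (k, s)" using \<theta>(1) k(2) by (simp add: P_def)
    moreover have "(k, s) \<in> K" using k(1) by (simp add: K_def s_def)
    ultimately show ?thesis by blast
  qed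
  have piece: "(\<integral>\<^sup>+\<theta>. ennreal (1 / p \<theta>) * indicator (P i) \<theta> \<partial>lborel) \<le> ennreal (41/50 / t / (1 - 41/50 / t))" if "i \<in> K" for i
  proof (rule nn_integral_inverse_on_short_set)
    obtain k s where i: "i = (k, s)" by (cases i)
    have s: "s \<in> {-1, 1}" using that by (auto simp: i K_def)
    have *: "a k s \<theta>' - a k s \<theta> \<le> 41/50 / t * max (p \<theta>) (p \<theta>')"
      if "\<theta> \<in> P i" "\<theta>' \<in> P i" "a k s \<theta> \<le> a k s \<theta>'" for \<theta> \<theta>'
    proof -
      let ?m = "max (p \<theta>) (p \<theta>')" and ?d = "a k s \<theta>' - a k s \<theta>"
      have w: "cmod x * cos (a k s \<theta>) \<le> t + (p \<theta>)\<^sup>2 / (4 * t)" "t \<le> cmod x * cos (a k s \<theta>')"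
        using that unfolding P_def i W_def inner_cis cos_a[OF s] by auto
      have "cmod x * cos (a k s \<theta>') \<le> cmod x * 1" by (intro mult_left_mono) auto
      with w have "t \<le> cmod x" by simp
      have cd: "3/8 * ?d\<^sup>2 \<le> cos (a k s \<theta>) - cos (a k s \<theta>')"
        using that by (intro cos_diff_ge) (auto simp: P_def i)
      have "t * (3/8 * ?d\<^sup>2) \<le> cmod x * (cos (a k s \<theta>) - cos (a k s \<theta>'))"
        using \<open>t \<le> cmod x\<close> t by (intro mult_mono cd) auto
      also have "\<dots> \<le> (p \<theta>)\<^sup>2 / (4 * t)" using w by (simp add: algebra_simps)
      also have "\<dots> \<le> ?m\<^sup>2 / (4 * t)" using p0[of \<theta>] t by (intro divide_right_mono power_mono) auto
      finally have "8/3 / t * (t * (3/8 * ?d\<^sup>2)) \<le> 8/3 / t * (?m\<^sup>2 / (4 * t))" using t by (intro mult_left_mono) auto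
      then have "?d\<^sup>2 \<le> 8/3 / t * (?m\<^sup>2 / (4 * t))" using t by simp
      also have "\<dots> = 2/3 * (?m / t)\<^sup>2" by (simp add: power2_eq_square)
      \<comment> \<open>The number \<open>41/50\<close> is a rational upper bound for the square
        root of \<open>2/3\<close>.\<close>
      also have "\<dots> \<le> 1681/2500 * (?m / t)\<^sup>2" by (intro mult_right_mono) auto
      also have "\<dots> = (41/50 / t * ?m)\<^sup>2" by (simp add: power_divide power_mult_distrib)
      finally show ?thesis
        by (rule power2_le_imp_le) (use t p0[of \<theta>] in \<open>simp add: le_max_iff_disj less_imp_le\<close>)
    qed
    have a_diff: "\<bar>a k s \<theta> - a k s \<theta>'\<bar> = \<bar>\<theta> - \<theta>'\<bar>" for \<theta> \<theta>'
    proof -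
      have "a k s \<theta> - a k s \<theta>' = s * (\<theta> - \<theta>')" by (simp add: a_def algebra_simps)
      moreover have "\<bar>s\<bar> = 1" using s by auto
      ultimately show ?thesis by (simp add: abs_mult)
    qed
    show "\<bar>\<theta> - \<theta>'\<bar> \<le> 41/50 / t * max (p \<theta>) (p \<theta>')" if "\<theta> \<in> P i" "\<theta>' \<in> P i" for \<theta> \<theta>'
    proof (cases "a k s \<theta> \<le> a k s \<theta>'")
      case True
      with *[OF that] a_diff[of \<theta> \<theta>'] show ?thesis by linarith
    next
      case False
      with *[OF that(2,1)] a_diff[of \<theta> \<theta>'] show ?thesis unfolding max.commute[of "p \<theta>"] by linarith
    qed
    show "P i \<in> sets lborel" using Pm by simp
    show "0 \<le> 41/50 / t" "41/50 / t < 1" using assms(3) by (auto simp: divide_less_eq)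
  qed (rule p0 lip)+
  have "(\<integral>\<^sup>+\<theta>\<in>{-4..4}. ennreal (t / p \<theta>) * indicator W \<theta> \<partial>lborel)
      \<le> (\<integral>\<^sup>+\<theta>. (\<Sum>i\<in>K. ennreal t * (ennreal (1 / p \<theta>) * indicator (P i) \<theta>)) \<partial>lborel)"
  proof (intro nn_integral_mono)
    fix \<theta>
    show "ennreal (t / p \<theta>) * indicator W \<theta> * indicator {-4..4} \<theta> \<le> (\<Sum>i\<in>K. ennreal t * (ennreal (1 / p \<theta>) * indicator (P i) \<theta>))"
    proof (cases "\<theta> \<in> W \<and> \<theta> \<in> {-4..4}")
      case True
      then obtain i where i: "i \<in> K" "\<theta> \<in> P i" using cover by blast
      then have "ennreal (t / p \<theta>) = ennreal t * (ennreal (1 / p \<theta>) * indicator (P i) \<theta>)"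
        using t p0[of \<theta>] by (simp flip: ennreal_mult)
      also have "\<dots> \<le> (\<Sum>i\<in>K. ennreal t * (ennreal (1 / p \<theta>) * indicator (P i) \<theta>))"
        using i(1) by (intro member_le_sum) (auto simp: K_def)
      finally show ?thesis using True by simp
    qed auto
  qed
  also have "\<dots> = (\<Sum>i\<in>K. ennreal t * (\<integral>\<^sup>+\<theta>. (ennreal (1 / p \<theta>) * indicator (P i) \<theta>) \<partial>lborel))"
    using Pm by (subst nn_integral_sum) (auto simp: nn_integral_cmult)
  also have "\<dots> \<le> (\<Sum>i\<in>K. ennreal t * ennreal (41/50 / t / (1 - 41/50 / t)))"
    by (intro sum_mono mult_left_mono piece) auto
  also have "\<dots> = 6 * (ennreal t * ennreal (41/50 / t / (1 - 41/50 / t)))"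
    by (simp add: K_def)
  also have "\<dots> \<le> 6 * ennreal (123/109)"
  proof (intro mult_left_mono)
    have "41/50 / t \<le> 41/150" using assms(3) by (simp add: divide_le_eq)
    then have "41/50 / (1 - 41/50 / t) \<le> (41/50) / (109/150)" by (intro divide_left_mono) auto
    then have "t * (41/50 / t / (1 - 41/50 / t)) \<le> 123/109" using t by simp
    then show "ennreal t * ennreal (41/50 / t / (1 - 41/50 / t)) \<le> ennreal (123/109)"
      using t by (subst ennreal_mult'[symmetric]) (auto intro: ennreal_leI)
  qed simp
  also have "\<dots> = ennreal (738/109)"
    by (subst ennreal_numeral[symmetric], subst ennreal_mult[symmetric]) auto
  finally show ?thesis by (simp add: W_def)
qed

text \<open>Only angles within \<open>d = s / (4 * t)\<close> of the argument of \<open>x\<close>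
  are used. There \<open>p\<close> stays within \<open>s / 12\<close> of \<open>s\<close>, and the
  projection of \<open>x\<close> falls short of \<open>t\<close> by at most
  \<open>s^2 / (32 * t)\<close>, which the lowering of the threshold by \<open>2 * p^2 / t\<close>
  outweighs.\<close>

lemma averaged_cube_ge:
  fixes p :: "real \<Rightarrow> real" and x :: complex
  assumes p0: "\<And>\<theta>. 0 < p \<theta>" and p1: "\<And>\<theta>. p \<theta> \<le> 1"
    and lip: "\<And>\<theta> \<theta>'. \<bar>p \<theta> - p \<theta>'\<bar> \<le> \<bar>\<theta> - \<theta>'\<bar>" and "3 \<le> t" "t \<le> cmod x"
  shows "ennreal (32/25 / t^4)
    \<le> (\<integral>\<^sup>+\<theta>\<in>{-4..4}. ennreal (1 / p \<theta> ^ 7) * ennreal (max 0 (x \<bullet> cis \<theta> - (t - 2 * (p \<theta>)\<^sup>2 / t)) ^ 3) \<partial>lborel)"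
proof -
  define s where "s = p (Arg x)"
  have s: "0 < s" "s \<le> 1" using p0 p1 by (auto simp: s_def)
  have t: "0 < t" using assms by simp
  define d where "d = s / (4 * t)"
  have d: "0 < d" "d \<le> s / 12" using s assms(4) by (auto simp: d_def field_simps)
  define J where "J = {Arg x - d .. Arg x + d}"
  define v where "v = (1649/1000 * s\<^sup>2 / t) ^ 3 / (13/12 * s) ^ 7"
  have v: "v \<le> 1 / p \<theta> ^ 7 * max 0 (x \<bullet> cis \<theta> - (t - 2 * (p \<theta>)\<^sup>2 / t)) ^ 3" if "\<theta> \<in> J" for \<theta>
  proof -
    define \<alpha> where "\<alpha> = \<theta> - Arg x"
    have \<alpha>: "\<bar>\<alpha>\<bar> \<le> d" using that by (auto simp: J_def \<alpha>_def)
    have "\<bar>p \<theta> - s\<bar> \<le> d" using lip[of \<theta> "Arg x"] \<alpha> by (simp add: s_def \<alpha>_def)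
    then have p: "11/12 * s \<le> p \<theta>" "p \<theta> \<le> 13/12 * s" using d by auto
    have "\<alpha>\<^sup>2 \<le> d\<^sup>2" using \<alpha> d by (intro power2_le_iff_abs_le[THEN iffD2]) auto
    have "(sin (\<alpha> / 2))\<^sup>2 \<le> (\<alpha> / 2)\<^sup>2" using abs_sin_x_le_abs_x[of "\<alpha> / 2"] by (simp only: abs_le_square_iff)
    moreover have "cos \<alpha> = 1 - 2 * (sin (\<alpha> / 2))\<^sup>2" using cos_double_sin[of "\<alpha> / 2"] by simp
    ultimately have cos: "1 - d\<^sup>2 / 2 \<le> cos \<alpha>" using \<open>\<alpha>\<^sup>2 \<le> d\<^sup>2\<close> by (simp add: power_divide)
    have "d\<^sup>2 \<le> 1" using d s by (intro power_le_one) auto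
    have "t - s\<^sup>2 / (32 * t) = t * (1 - d\<^sup>2 / 2)"
      using t by (simp add: d_def field_simps power2_eq_square)
    also have "\<dots> \<le> cmod x * cos \<alpha>"
      using assms(5) t \<open>d\<^sup>2 \<le> 1\<close> by (intro mult_mono cos) auto
    also have "\<dots> = x \<bullet> cis \<theta>" by (simp add: inner_cis \<alpha>_def)
    finally have x: "t - s\<^sup>2 / (32 * t) \<le> x \<bullet> cis \<theta>" .
    have "(11/12 * s)\<^sup>2 \<le> (p \<theta>)\<^sup>2" using p s by (intro power_mono) auto
    then have "121/144 * s\<^sup>2 \<le> (p \<theta>)\<^sup>2" by (simp add: power_mult_distrib power_divide)
    \<comment> \<open>The constant is just below \<open>2 * 121/144 - 1/32\<close>.\<close>
    then have "1649/1000 * s\<^sup>2 \<le> 2 * (p \<theta>)\<^sup>2 - s\<^sup>2 / 32" using zero_le_power2[of s] by linarith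
    then have "1649/1000 * s\<^sup>2 / t \<le> (2 * (p \<theta>)\<^sup>2 - s\<^sup>2 / 32) / t" using t by (intro divide_right_mono) auto
    also have "\<dots> = 2 * (p \<theta>)\<^sup>2 / t - s\<^sup>2 / (32 * t)" by (simp add: diff_divide_distrib)
    also have "\<dots> \<le> max 0 (x \<bullet> cis \<theta> - (t - 2 * (p \<theta>)\<^sup>2 / t))" using x by linarith
    finally have "1649/1000 * s\<^sup>2 / t \<le> max 0 (x \<bullet> cis \<theta> - (t - 2 * (p \<theta>)\<^sup>2 / t))" .
    then have "v \<le> max 0 (x \<bullet> cis \<theta> - (t - 2 * (p \<theta>)\<^sup>2 / t)) ^ 3 / p \<theta> ^ 7"
      unfolding v_def using p s t p0[of \<theta>] by (intro frac_le power_mono zero_less_power zero_le_power) auto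
    then show ?thesis by simp
  qed
  \<comment> \<open>The range \<open>[-4, 4]\<close> exceeds a full period so that this
    neighbourhood fits even when the argument is close to \<open>pi\<close> or
    \<open>-pi\<close>.\<close>
  have J: "J \<subseteq> {-4..4}" using d s Arg_bounded[of x] pi_approx by (auto simp: J_def)
  have v0: "0 \<le> v" using s t by (simp add: v_def)
  \<comment> \<open>The weight \<open>1 / p^7\<close> is chosen for this: the powers
    \<open>s^6\<close>, \<open>s^-7\<close> and \<open>s\<close> cancel.\<close>
  have "32/25 / t^4 \<le> v * (2 * d)"
    using s t by (simp add: v_def d_def field_simps eval_nat_numeral)
  then have "ennreal (32/25 / t^4) \<le> ennreal v * emeasure lborel J"
    using d v0 by (simp add: J_def ennreal_mult[symmetric] ennreal_leI)
  also have "\<dots> = (\<integral>\<^sup>+\<theta>. ennreal v * indicator J \<theta> \<partial>lborel)"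
    by (simp add: J_def nn_integral_cmult_indicator)
  also have "\<dots> \<le> (\<integral>\<^sup>+\<theta>\<in>{-4..4}. ennreal (1 / p \<theta> ^ 7) * ennreal (max 0 (x \<bullet> cis \<theta> - (t - 2 * (p \<theta>)\<^sup>2 / t)) ^ 3) \<partial>lborel)"
  proof (intro nn_integral_mono)
    fix \<theta>
    show "ennreal v * indicator J \<theta> \<le> ennreal (1 / p \<theta> ^ 7) * ennreal (max 0 (x \<bullet> cis \<theta> - (t - 2 * (p \<theta>)\<^sup>2 / t)) ^ 3) * indicator {-4..4} \<theta>"
      using v[of \<theta>] J p0[of \<theta>]
      by (cases "\<theta> \<in> J") (auto simp: ennreal_mult[symmetric] intro!: ennreal_leI)
  qed
  finally show ?thesis .
qed

subsection \<open>The planar case\<close>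

text \<open>The assumptions \<open>le1\<close>, \<open>pos\<close> and \<open>w0\<close> express the
  normalization: the standard deviation of the Gaussian marginal is positive in every direction and
  has maximum 1, attained at \<open>w0\<close>.\<close>

lemma planar_rademacher_gaussian_tail:
  fixes M :: "'a measure" and N :: "'b measure"
    and \<epsilon> :: "'i \<Rightarrow> 'a \<Rightarrow> real" and g :: "'i \<Rightarrow> 'b \<Rightarrow> real" and z :: "'i \<Rightarrow> complex"
  assumes M: "prob_space M" and N: "prob_space N" and I: "finite I"
    and ind_\<epsilon>: "prob_space.indep_vars M (\<lambda>_. borel) \<epsilon> I" and \<epsilon>: "\<And>i. i \<in> I \<Longrightarrow> rademacher M (\<epsilon> i)"
    and ind_g: "prob_space.indep_vars N (\<lambda>_. borel) g I" and g: "\<And>i. i \<in> I \<Longrightarrow> standard_gaussian N (g i)"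
    and le1: "\<And>w. L2_set (\<lambda>i. z i \<bullet> w) I \<le> cmod w"
    and pos: "\<And>w. w \<noteq> 0 \<Longrightarrow> 0 < L2_set (\<lambda>i. z i \<bullet> w) I"
    and w0: "cmod w0 = 1" "L2_set (\<lambda>i. z i \<bullet> w0) I = 1"
  shows "\<P>(\<omega> in M. t \<le> cmod (\<Sum>i\<in>I. \<epsilon> i \<omega> *\<^sub>R z i))
     \<le> 3824 * \<P>(\<omega> in N. t \<le> cmod (\<Sum>i\<in>I. g i \<omega> *\<^sub>R z i))"
proof -
  interpret M: prob_space M by fact
  interpret N: prob_space N by fact
  interpret LM: pair_sigma_finite lborel M ..
  interpret LN: pair_sigma_finite lborel N ..
  have \<epsilon>_meas: "i \<in> I \<Longrightarrow> \<epsilon> i \<in> borel_measurable M" for i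
    using \<epsilon> by (simp add: rademacher_def)
  have g_meas: "i \<in> I \<Longrightarrow> g i \<in> borel_measurable N" for i
    using g by (simp add: standard_gaussian_def distributed_def)
  define S where "S \<omega> = (\<Sum>i\<in>I. \<epsilon> i \<omega> *\<^sub>R z i)" for \<omega>
  define G where "G \<omega> = (\<Sum>i\<in>I. g i \<omega> *\<^sub>R z i)" for \<omega>
  have [measurable]: "S \<in> borel_measurable M" "G \<in> borel_measurable N"
    unfolding S_def G_def using \<epsilon>_meas g_meas by (auto intro!: borel_measurable_sum borel_measurable_scaleR)
  define p where "p \<theta> = L2_set (\<lambda>i. z i \<bullet> cis \<theta>) I" for \<theta>
  have p0: "0 < p \<theta>" for \<theta> unfolding p_def by (rule pos) simp
  have p1: "p \<theta> \<le> 1" for \<theta> using le1[of "cis \<theta>"] by (simp add: p_def)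
  \<comment> \<open>The map from \<open>w\<close> to the standard deviation is a seminorm bounded by
    the norm, and a chord is no longer than its arc.\<close>
  have lip: "\<bar>p \<theta> - p \<theta>'\<bar> \<le> \<bar>\<theta> - \<theta>'\<bar>" for \<theta> \<theta>'
  proof -
    have tri: "L2_set (\<lambda>i. z i \<bullet> v) I \<le> L2_set (\<lambda>i. z i \<bullet> w) I + cmod (v - w)" for v w
    proof -
      have "L2_set (\<lambda>i. z i \<bullet> v) I = L2_set (\<lambda>i. z i \<bullet> w + z i \<bullet> (v - w)) I"
        by (simp add: inner_diff_right)
      also have "\<dots> \<le> L2_set (\<lambda>i. z i \<bullet> w) I + L2_set (\<lambda>i. z i \<bullet> (v - w)) I" by (rule L2_set_triangle_ineq)
      finally show ?thesis using le1[of "v - w"] by simp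
    qed
    have "cmod (cis \<theta> - cis \<theta>') \<le> \<bar>\<theta> - \<theta>'\<bar>"
    proof -
      have "cmod (cis \<theta> - cis \<theta>') = cmod (cis \<theta>' * (cis (\<theta> - \<theta>') - 1))"
        by (simp add: algebra_simps cis_mult)
      also have "\<dots> = cmod (cis (\<theta> - \<theta>') - 1)" by (simp only: norm_mult norm_cis mult_1)
      also have "\<dots> = cmod (exp (\<i> * complex_of_real (\<theta> - \<theta>')) - 1)" by (simp only: cis_conv_exp)
      also have "\<dots> = 2 * \<bar>sin ((\<theta> - \<theta>') / 2)\<bar>" by (rule dist_exp_i_1)
      also have "\<dots> \<le> \<bar>\<theta> - \<theta>'\<bar>" using abs_sin_x_le_abs_x[of "(\<theta> - \<theta>') / 2"] by simp
      finally show ?thesis .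
    qed
    then show ?thesis using tri[of "cis \<theta>" "cis \<theta>'"] tri[of "cis \<theta>'" "cis \<theta>"]
      by (simp add: p_def abs_le_iff norm_minus_commute)
  qed
  have inner_S: "S \<omega> \<bullet> w = (\<Sum>i\<in>I. (z i \<bullet> w) * \<epsilon> i \<omega>)" for \<omega> w
    by (simp add: S_def inner_sum_left mult.commute)
  have inner_G: "G \<omega> \<bullet> w = (\<Sum>i\<in>I. (z i \<bullet> w) * g i \<omega>)" for \<omega> w
    by (simp add: G_def inner_sum_left mult.commute)
  have distr: "distributed N lborel (\<lambda>\<omega>. G \<omega> \<bullet> w) (normal_density 0 (L2_set (\<lambda>i. z i \<bullet> w) I))" if "w \<noteq> 0" for w
    unfolding inner_G using pos[OF that] by (intro distributed_gaussian_combination N I ind_g g)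
  define A where "A = M.prob {\<omega>\<in>space M. t \<le> cmod (S \<omega>)}"
  define B where "B = N.prob {\<omega>\<in>space N. t \<le> cmod (G \<omega>)}"
  have sqrt_pi: "0 < sqrt (2 * pi)" "sqrt (2 * pi) \<le> 13/5"
    using pi_approx by (simp, intro real_le_lsqrt) (auto simp: power2_eq_square)
  have "A \<le> 3824 * B"
  proof (cases "t < 3")
    case True
    have "w0 \<noteq> 0" using w0 by auto
    \<comment> \<open>The marginal along \<open>w0\<close> is standard normal; the width
      \<open>1/3\<close> nearly maximizes this lower bound for its tail beyond 3.\<close>
    have "ennreal (1/3 / 1 * exp (- (3 + 1/3)\<^sup>2 / (2 * 1\<^sup>2)) / sqrt (2 * pi))
        \<le> emeasure N {\<omega>\<in>space N. 3 \<le> G \<omega> \<bullet> w0 \<and> G \<omega> \<bullet> w0 \<le> 3 + 1/3}"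
      using distr[OF \<open>w0 \<noteq> 0\<close>] w0 by (intro normal_interval_ge) auto
    also have "\<dots> \<le> emeasure N {\<omega>\<in>space N. t \<le> cmod (G \<omega>)}"
    proof (intro emeasure_mono subsetI)
      fix \<omega> assume "\<omega> \<in> {\<omega>\<in>space N. 3 \<le> G \<omega> \<bullet> w0 \<and> G \<omega> \<bullet> w0 \<le> 3 + 1/3}"
      then show "\<omega> \<in> {\<omega>\<in>space N. t \<le> cmod (G \<omega>)}"
        using norm_cauchy_schwarz[of "G \<omega>" w0] w0 True by auto
    qed simp
    finally have "exp (-50/9) / (3 * sqrt (2 * pi)) \<le> B"
      by (simp add: B_def N.emeasure_eq_measure power2_eq_square field_simps)
    moreover have "1 / 3824 \<le> exp (-50/9) / (3 * sqrt (2 * pi))"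
    proof -
      have "exp (50/9 :: real) = exp 1 ^ 5 * exp (5/9)" by (simp flip: exp_add exp_of_nat_mult)
      also have "exp (1::real) ^ 5 \<le> (272/100) ^ 5" using e_less_272 by (intro power_mono) auto
      also have "exp (5/9::real) \<le> 9/4"
        using exp_ge_add_one_self[of "-(5/9)::real"] by (simp add: exp_minus field_simps)
      finally have e: "exp (50/9 :: real) \<le> (272/100) ^ 5 * (9/4)" by simp
      have "exp (50/9) * (3 * sqrt (2 * pi)) \<le> ((272/100) ^ 5 * (9/4)) * (3 * (13/5))"
        using sqrt_pi e by (intro mult_mono) auto
      also have "\<dots> \<le> 3824" by (simp add: power_divide)
      finally show ?thesis using sqrt_pi(1) by (simp add: exp_minus field_simps)
    qed
    ultimately have "1 / 3824 \<le> B" by (rule order_trans[rotated])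
    moreover have "A \<le> 1" by (simp add: A_def)
    ultimately show ?thesis by simp
  next
    case False
    then have t3: "3 \<le> t" and t: "0 < t" by auto
    have [measurable]: "p \<in> borel_measurable borel"
      unfolding p_def L2_set_def inner_complex_def by simp
    \<comment> \<open>Lowering the threshold from \<open>t\<close> by \<open>2 * p^2 / t\<close>
      costs at most the factor \<open>exp 2\<close> in the Gaussian exponent, uniformly in
      \<open>p\<close>.\<close>
    define u where "u \<theta> = t - 2 * (p \<theta>)\<^sup>2 / t" for \<theta>
    have [measurable]: "u \<in> borel_measurable borel" unfolding u_def by simp
    have cis_meas [measurable]: "cis \<in> borel_measurable borel"
      by (intro borel_measurable_continuous_onI continuous_intros)
    define E where "E \<theta> = exp (- t\<^sup>2 / (2 * (p \<theta>)\<^sup>2)) / sqrt (2 * pi)" for \<theta>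
    have [measurable]: "E \<in> borel_measurable borel" unfolding E_def by simp
    have E0: "0 \<le> E \<theta>" for \<theta> by (simp add: E_def)
    \<comment> \<open>Some directions occur twice in \<open>[-4, 4]\<close>; this does no harm,
      since both tails are compared with the same \<open>J\<close>.\<close>
    define J where "J = (\<integral>\<^sup>+\<theta>\<in>{-4..4}. ennreal (E \<theta>) \<partial>lborel)"
    have u_bounds: "7/9 * t \<le> u \<theta>" "t\<^sup>2 - 4 * (p \<theta>)\<^sup>2 \<le> (u \<theta>)\<^sup>2" for \<theta>
    proof -
      have "(p \<theta>)\<^sup>2 \<le> 1" using p0[of \<theta>] p1[of \<theta>] by (intro power_le_one) auto
      moreover have "3 * 3 \<le> t * t" using t3 by (intro mult_mono) auto
      ultimately have "2 * (p \<theta>)\<^sup>2 \<le> 2/9 * (t * t)" by simp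
      then show "7/9 * t \<le> u \<theta>" using t by (simp add: u_def field_simps)
      have "(u \<theta>)\<^sup>2 = t\<^sup>2 - 4 * (p \<theta>)\<^sup>2 + (2 * (p \<theta>)\<^sup>2 / t)\<^sup>2"
        using t by (simp add: u_def power2_diff)
      then show "t\<^sup>2 - 4 * (p \<theta>)\<^sup>2 \<le> (u \<theta>)\<^sup>2" by simp
    qed
    have cube: "ennreal (1 / p \<theta> ^ 7) * (\<integral>\<^sup>+\<omega>. ennreal (max 0 (S \<omega> \<bullet> cis \<theta> - u \<theta>) ^ 3) \<partial>M)
       \<le> ennreal (122 / t^4) * ennreal (E \<theta>)" for \<theta>
    proof -
      have u0: "0 < u \<theta>" using u_bounds(1)[of \<theta>] t by linarith
      have "(\<integral>\<^sup>+\<omega>. ennreal (max 0 (S \<omega> \<bullet> cis \<theta> - u \<theta>) ^ 3) \<partial>M)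
          = (\<integral>\<^sup>+\<omega>. ennreal (max 0 (- u \<theta> + (\<Sum>i\<in>I. (z i \<bullet> cis \<theta>) * \<epsilon> i \<omega>)) ^ 3) \<partial>M)"
        by (simp add: inner_S)
      also have "\<dots> \<le> (\<integral>\<^sup>+\<omega>. ennreal (max 0 (- u \<theta> + (\<Sum>i\<in>I. (z i \<bullet> cis \<theta>) * g i \<omega>)) ^ 3) \<partial>N)"
      proof (rule nn_integral_sum_indep_mono[OF M N I, where h="\<lambda>y. ennreal (max 0 y ^ 3)"])
        show "M.indep_vars (\<lambda>_. borel) (\<lambda>i \<omega>. (z i \<bullet> cis \<theta>) * \<epsilon> i \<omega>) I"
          by (rule M.indep_vars_compose2[OF ind_\<epsilon>, where Y="\<lambda>i y. (z i \<bullet> cis \<theta>) * y"]) auto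
        show "N.indep_vars (\<lambda>_. borel) (\<lambda>i \<omega>. (z i \<bullet> cis \<theta>) * g i \<omega>) I"
          by (rule N.indep_vars_compose2[OF ind_g, where Y="\<lambda>i y. (z i \<bullet> cis \<theta>) * y"]) auto
      qed (auto intro: rademacher_cube_le_gaussian_cube M \<epsilon> g)
      also have "\<dots> = (\<integral>\<^sup>+\<omega>. ennreal (max 0 (G \<omega> \<bullet> cis \<theta> - u \<theta>) ^ 3) \<partial>N)"
        by (simp add: inner_G)
      also have "\<dots> \<le> ennreal (6 * p \<theta> ^ 7 / u \<theta> ^ 4 * exp (- (u \<theta>)\<^sup>2 / (2 * (p \<theta>)\<^sup>2)) / sqrt (2 * pi))"
        using distr[of "cis \<theta>"] p0[of \<theta>] u0 by (intro nn_integral_normal_cube_le) (auto simp: p_def)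
      finally have "ennreal (1 / p \<theta> ^ 7) * (\<integral>\<^sup>+\<omega>. ennreal (max 0 (S \<omega> \<bullet> cis \<theta> - u \<theta>) ^ 3) \<partial>M)
        \<le> ennreal (1 / p \<theta> ^ 7) * ennreal (6 * p \<theta> ^ 7 / u \<theta> ^ 4 * exp (- (u \<theta>)\<^sup>2 / (2 * (p \<theta>)\<^sup>2)) / sqrt (2 * pi))"
        by (rule mult_left_mono) simp
      also have "\<dots> = ennreal (6 / u \<theta> ^ 4 * exp (- (u \<theta>)\<^sup>2 / (2 * (p \<theta>)\<^sup>2)) / sqrt (2 * pi))"
        using p0[of \<theta>] u0 by (simp add: ennreal_mult[symmetric])
      also have "\<dots> \<le> ennreal (122 / t^4 * E \<theta>)"
      proof (rule ennreal_leI)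
        have "6 / u \<theta> ^ 4 \<le> 6 / (7/9 * t) ^ 4"
          using u_bounds(1)[of \<theta>] t u0 by (intro divide_left_mono power_mono mult_pos_pos) auto
        also have "\<dots> = (6 * (9/7) ^ 4) / t ^ 4" by (simp add: power_mult_distrib power_divide)
        finally have 1: "6 / u \<theta> ^ 4 \<le> (6 * (9/7) ^ 4) / t ^ 4" .
        have "- (u \<theta>)\<^sup>2 / (2 * (p \<theta>)\<^sup>2) \<le> (4 * (p \<theta>)\<^sup>2 - t\<^sup>2) / (2 * (p \<theta>)\<^sup>2)"
          using u_bounds(2)[of \<theta>] by (intro divide_right_mono) auto
        also have "\<dots> = 2 + - t\<^sup>2 / (2 * (p \<theta>)\<^sup>2)"
          using p0[of \<theta>] by (simp add: field_simps)
        finally have "exp (- (u \<theta>)\<^sup>2 / (2 * (p \<theta>)\<^sup>2)) \<le> exp 2 * exp (- t\<^sup>2 / (2 * (p \<theta>)\<^sup>2))"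
          by (simp flip: exp_add)
        moreover have "exp (2::real) \<le> (272/100)\<^sup>2"
        proof -
          have "exp (2::real) = exp 1 ^ 2" by (simp flip: exp_of_nat_mult)
          also have "\<dots> \<le> (272/100)\<^sup>2" using e_less_272 by (intro power_mono) auto
          finally show ?thesis .
        qed
        ultimately have 2: "exp (- (u \<theta>)\<^sup>2 / (2 * (p \<theta>)\<^sup>2)) \<le> (272/100)\<^sup>2 * exp (- t\<^sup>2 / (2 * (p \<theta>)\<^sup>2))"
          by (meson exp_ge_zero mult_right_mono order_trans)
        have "6 / u \<theta> ^ 4 * exp (- (u \<theta>)\<^sup>2 / (2 * (p \<theta>)\<^sup>2)) / sqrt (2 * pi)
          \<le> (6 * (9/7) ^ 4) / t ^ 4 * ((272/100)\<^sup>2 * exp (- t\<^sup>2 / (2 * (p \<theta>)\<^sup>2))) / sqrt (2 * pi)"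
          using sqrt_pi t u0 by (intro divide_right_mono mult_mono 1 2) auto
        also have "\<dots> = (6 * (9/7) ^ 4 * (272/100)\<^sup>2) * (E \<theta> / t ^ 4)" by (simp add: E_def mult_ac)
        \<comment> \<open>The constant rounds up \<open>6 * (9/7)^4 * (272/100)^2\<close>, in which
          \<open>9/7\<close> comes from \<open>u \<ge> 7/9 * t\<close> and \<open>272/100\<close>
          bounds \<open>exp 1\<close>.\<close>
        also have "\<dots> \<le> 122 * (E \<theta> / t ^ 4)"
          using E0[of \<theta>] by (intro mult_right_mono) (auto simp: power_divide)
        finally show "6 / u \<theta> ^ 4 * exp (- (u \<theta>)\<^sup>2 / (2 * (p \<theta>)\<^sup>2)) / sqrt (2 * pi) \<le> 122 / t^4 * E \<theta>" by simp
      qed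
      finally show ?thesis using E0 by (subst ennreal_mult[symmetric]) auto
    qed
    \<comment> \<open>Markov's inequality for the averaged cube, followed by Tonelli and the bound
      for each direction.\<close>
    have "ennreal (32/25 / t^4) * ennreal A
       = (\<integral>\<^sup>+\<omega>. ennreal (32/25 / t^4) * indicator {\<omega>\<in>space M. t \<le> cmod (S \<omega>)} \<omega> \<partial>M)"
      by (simp add: nn_integral_cmult A_def M.emeasure_eq_measure)
    also have "\<dots> \<le> (\<integral>\<^sup>+\<omega>. (\<integral>\<^sup>+\<theta>\<in>{-4..4}. ennreal (1 / p \<theta> ^ 7) * ennreal (max 0 (S \<omega> \<bullet> cis \<theta> - u \<theta>) ^ 3) \<partial>lborel) \<partial>M)"
      using averaged_cube_ge[of p, OF p0 p1 lip t3]
      by (intro nn_integral_mono) (auto simp: indicator_def u_def)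
    also have "\<dots> = (\<integral>\<^sup>+\<theta>. \<integral>\<^sup>+\<omega>. ennreal (1 / p \<theta> ^ 7) * ennreal (max 0 (S \<omega> \<bullet> cis \<theta> - u \<theta>) ^ 3) * indicator {-4..4} \<theta> \<partial>M \<partial>lborel)"
      by (rule LM.Fubini') measurable
    also have "\<dots> = (\<integral>\<^sup>+\<theta>. ennreal (1 / p \<theta> ^ 7) * (\<integral>\<^sup>+\<omega>. ennreal (max 0 (S \<omega> \<bullet> cis \<theta> - u \<theta>) ^ 3) \<partial>M) * indicator {-4..4} \<theta> \<partial>lborel)"
      by (simp add: nn_integral_cmult nn_integral_multc)
    also have "\<dots> \<le> (\<integral>\<^sup>+\<theta>. (ennreal (122 / t^4) * ennreal (E \<theta>)) * indicator {-4..4} \<theta> \<partial>lborel)"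
      by (intro nn_integral_mono mult_right_mono cube) auto
    also have "\<dots> = ennreal (122 / t^4) * J"
      by (simp add: J_def mult.assoc nn_integral_cmult)
    finally have upper: "ennreal (32/25 / t^4) * ennreal A \<le> ennreal (122 / t^4) * J" .
    define W where "W x = {\<theta>. t \<le> x \<bullet> cis \<theta> \<and> x \<bullet> cis \<theta> \<le> t + (p \<theta>)\<^sup>2 / (4 * t)}" for x
    have window: "ennreal (9/50) * ennreal (E \<theta>) \<le> ennreal (t / p \<theta>) * (\<integral>\<^sup>+\<omega>. indicator (W (G \<omega>)) \<theta> \<partial>N)" for \<theta>
    proof -
      let ?w = "(p \<theta>)\<^sup>2 / (4 * t)"
      \<comment> \<open>The width is proportional to \<open>p^2 / t\<close> so that the exponent
        drops only by \<open>1/4\<close> and a small remainder, uniformly in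
        \<open>p\<close>.\<close>
      have "- (t + ?w)\<^sup>2 / (2 * (p \<theta>)\<^sup>2) = - t\<^sup>2 / (2 * (p \<theta>)\<^sup>2) + (- 1/4 - (p \<theta>)\<^sup>2 / (32 * t\<^sup>2))"
        using t p0[of \<theta>] by (simp add: field_simps power2_eq_square)
      then have "exp (- (t + ?w)\<^sup>2 / (2 * (p \<theta>)\<^sup>2)) = exp (- t\<^sup>2 / (2 * (p \<theta>)\<^sup>2)) * exp (- 1/4 - (p \<theta>)\<^sup>2 / (32 * t\<^sup>2))"
        by (simp only: exp_add)
      moreover have "18/25 \<le> exp (- 1/4 - (p \<theta>)\<^sup>2 / (32 * t\<^sup>2))"
      proof -
        have "(p \<theta>)\<^sup>2 \<le> 1" using p0[of \<theta>] p1[of \<theta>] by (intro power_le_one) auto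
        moreover have "3 * 3 \<le> t * t" using t3 by (intro mult_mono) auto
        ultimately have "(p \<theta>)\<^sup>2 / (32 * t\<^sup>2) \<le> 1 / (32 * 9)" by (intro frac_le) (auto simp: power2_eq_square)
        then show ?thesis using exp_ge_add_one_self[of "- 1/4 - (p \<theta>)\<^sup>2 / (32 * t\<^sup>2)"] by linarith
      qed
      ultimately have "exp (- t\<^sup>2 / (2 * (p \<theta>)\<^sup>2)) * (18/25) \<le> exp (- (t + ?w)\<^sup>2 / (2 * (p \<theta>)\<^sup>2))"
        by (metis exp_ge_zero mult_left_mono)
      then have "exp (- t\<^sup>2 / (2 * (p \<theta>)\<^sup>2)) * (18/25) / sqrt (2 * pi) \<le> exp (- (t + ?w)\<^sup>2 / (2 * (p \<theta>)\<^sup>2)) / sqrt (2 * pi)"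
        by (rule divide_right_mono) simp
      then have "E \<theta> * (18/25) \<le> exp (- (t + ?w)\<^sup>2 / (2 * (p \<theta>)\<^sup>2)) / sqrt (2 * pi)"
        by (simp add: E_def)
      then have "9/50 * E \<theta> \<le> 1/4 * (exp (- (t + ?w)\<^sup>2 / (2 * (p \<theta>)\<^sup>2)) / sqrt (2 * pi))" by linarith
      also have "\<dots> = t / p \<theta> * (?w / p \<theta> * exp (- (t + ?w)\<^sup>2 / (2 * (p \<theta>)\<^sup>2)) / sqrt (2 * pi))"
        using t p0[of \<theta>] by (simp add: power2_eq_square)
      finally have "ennreal (9/50) * ennreal (E \<theta>)
         \<le> ennreal (t / p \<theta>) * ennreal (?w / p \<theta> * exp (- (t + ?w)\<^sup>2 / (2 * (p \<theta>)\<^sup>2)) / sqrt (2 * pi))"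
        using t p0[of \<theta>] E0[of \<theta>] by (subst (1 2) ennreal_mult[symmetric]) (auto intro!: ennreal_leI)
      also have "\<dots> \<le> ennreal (t / p \<theta>) * emeasure N {\<omega>\<in>space N. t \<le> G \<omega> \<bullet> cis \<theta> \<and> G \<omega> \<bullet> cis \<theta> \<le> t + ?w}"
        using distr[of "cis \<theta>"] p0[of \<theta>] t by (intro mult_left_mono normal_interval_ge) (auto simp: p_def)
      also have "emeasure N {\<omega>\<in>space N. t \<le> G \<omega> \<bullet> cis \<theta> \<and> G \<omega> \<bullet> cis \<theta> \<le> t + ?w} = (\<integral>\<^sup>+\<omega>. indicator (W (G \<omega>)) \<theta> \<partial>N)"
      proof -
        have "(\<integral>\<^sup>+\<omega>. indicator (W (G \<omega>)) \<theta> \<partial>N)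
            = (\<integral>\<^sup>+\<omega>. indicator {\<omega>\<in>space N. t \<le> G \<omega> \<bullet> cis \<theta> \<and> G \<omega> \<bullet> cis \<theta> \<le> t + ?w} \<omega> \<partial>N)"
          by (intro nn_integral_cong) (auto simp: W_def indicator_def)
        then show ?thesis by (subst (asm) nn_integral_indicator) simp_all
      qed
      finally show ?thesis .
    qed
    have W_meas [measurable]: "Measurable.pred (lborel \<Otimes>\<^sub>M N) (\<lambda>x. fst x \<in> W (G (snd x)))"
      unfolding W_def by simp
    have ind_W: "indicator (W x) \<theta> = (if \<theta> \<in> W x then 1 else 0 :: ennreal)" for x \<theta>
      by (simp add: indicator_def)
    have "ennreal (9/50) * J = (\<integral>\<^sup>+\<theta>. (ennreal (9/50) * ennreal (E \<theta>)) * indicator {-4..4} \<theta> \<partial>lborel)"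
      by (simp add: J_def mult.assoc nn_integral_cmult)
    also have "\<dots> \<le> (\<integral>\<^sup>+\<theta>. (ennreal (t / p \<theta>) * (\<integral>\<^sup>+\<omega>. indicator (W (G \<omega>)) \<theta> \<partial>N)) * indicator {-4..4} \<theta> \<partial>lborel)"
      by (intro nn_integral_mono mult_right_mono window) auto
    also have "\<dots> = (\<integral>\<^sup>+\<theta>. \<integral>\<^sup>+\<omega>. ennreal (t / p \<theta>) * indicator (W (G \<omega>)) \<theta> * indicator {-4..4} \<theta> \<partial>N \<partial>lborel)"
      by (simp add: nn_integral_cmult nn_integral_multc W_def indicator_def)
    also have "\<dots> = (\<integral>\<^sup>+\<omega>. (\<integral>\<^sup>+\<theta>\<in>{-4..4}. ennreal (t / p \<theta>) * indicator (W (G \<omega>)) \<theta> \<partial>lborel) \<partial>N)"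
      by (rule LN.Fubini'[symmetric]) (simp add: W_def indicator_def)
    also have "\<dots> \<le> (\<integral>\<^sup>+\<omega>. ennreal (738/109) * indicator {\<omega>\<in>space N. t \<le> cmod (G \<omega>)} \<omega> \<partial>N)"
    proof (intro nn_integral_mono)
      fix \<omega> assume "\<omega> \<in> space N"
      show "(\<integral>\<^sup>+\<theta>\<in>{-4..4}. ennreal (t / p \<theta>) * indicator (W (G \<omega>)) \<theta> \<partial>lborel)
         \<le> ennreal (738/109) * indicator {\<omega>\<in>space N. t \<le> cmod (G \<omega>)} \<omega>"
      proof (cases "t \<le> cmod (G \<omega>)")
        case True
        then show ?thesis using window_integral_le[of p t "G \<omega>", OF p0 lip t3] \<open>\<omega> \<in> space N\<close> by (simp add: W_def)
      next
        case False
        moreover have "G \<omega> \<bullet> cis \<theta> \<le> cmod (G \<omega>)" for \<theta>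
          using norm_cauchy_schwarz[of "G \<omega>" "cis \<theta>"] by simp
        ultimately have "W (G \<omega>) = {}" by (force simp: W_def intro: order_trans)
        then show ?thesis by simp
      qed
    qed
    also have "\<dots> = ennreal (738/109) * ennreal B"
      by (simp add: nn_integral_cmult B_def N.emeasure_eq_measure)
    also have "\<dots> = ennreal (738/109 * B)"
      by (rule ennreal_mult'[symmetric]) simp
    finally have lower: "ennreal (9/50) * J \<le> ennreal (738/109 * B)" .
    \<comment> \<open>Finiteness follows from the lower bound, as \<open>B\<close> is a real
      number.\<close>
    have "J < \<top>"
    proof (rule ccontr)
      assume "\<not> J < \<top>"
      then have "J = \<top>" using less_top by blast
      with lower show False by (simp add: ennreal_mult_top top_unique)
    qed
    then obtain j where j: "J = ennreal j" "0 \<le> j" by (cases J) auto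
    have "0 \<le> A" "0 \<le> B" by (auto simp: A_def B_def)
    have "9/50 * j \<le> 738/109 * B"
      using lower \<open>0 \<le> B\<close> j by (simp add: ennreal_mult[symmetric])
    moreover have "32/25 / t^4 * A \<le> 122 / t^4 * j"
      using upper \<open>0 \<le> A\<close> j t by (simp add: ennreal_mult[symmetric])
    then have "32/25 * A \<le> 122 * j" using t by (simp add: field_simps)
    \<comment> \<open>Eliminating \<open>j\<close> leaves the factor
      \<open>122 * 25/32 * 50/9 * 738/109\<close>, which is about 3585.\<close>
    ultimately show ?thesis using \<open>0 \<le> B\<close> by linarith
  qed
  then show ?thesis by (simp add: A_def B_def S_def G_def)
qed

section \<open>Normalization and reduction to the plane\<close>

text \<open>A vector orthogonal to all \<open>z i\<close> is orthogonal to itself because they span,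
  hence positivity. Compactness of the circle gives a maximizer, and homogeneity extends its bound
  to all \<open>w\<close>.\<close>

lemma L2_set_inner_max_on_circle:
  fixes z :: "'i \<Rightarrow> complex"
  assumes "finite I" and span: "span (z ` I) = UNIV"
  obtains w0 where "cmod w0 = 1" "0 < L2_set (\<lambda>i. z i \<bullet> w0) I"
    "\<And>w. L2_set (\<lambda>i. z i \<bullet> w) I \<le> L2_set (\<lambda>i. z i \<bullet> w0) I * cmod w"
    "\<And>w. w \<noteq> 0 \<Longrightarrow> 0 < L2_set (\<lambda>i. z i \<bullet> w) I"
proof -
  let ?p = "\<lambda>w. L2_set (\<lambda>i. z i \<bullet> w) I"
  have pos: "0 < ?p w" if "w \<noteq> 0" for w
  proof (rule ccontr)
    assume "\<not> 0 < ?p w"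
    then have "?p w = 0" using L2_set_nonneg[of "\<lambda>i. z i \<bullet> w" I] by simp
    then have "\<forall>i\<in>I. z i \<bullet> w = 0" using \<open>finite I\<close> by (simp add: L2_set_eq_0_iff)
    then have "orthogonal w y" if "y \<in> span (z ` I)" for y
      using that by (intro orthogonal_to_span[of y "z ` I"]) (auto simp: orthogonal_def inner_commute)
    then have "orthogonal w w" by (simp add: span)
    with that show False by (simp add: orthogonal_def)
  qed
  have "continuous_on (sphere 0 1) ?p"
    unfolding L2_set_def by (intro continuous_intros)
  then obtain w0 where w0: "w0 \<in> sphere 0 1" "\<And>w. w \<in> sphere 0 1 \<Longrightarrow> ?p w \<le> ?p w0"
    using continuous_attains_sup[of "sphere 0 1" ?p] by auto
  have "?p w \<le> ?p w0 * cmod w" for w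
  proof (cases "w = 0")
    case True
    then show ?thesis by (simp add: L2_set_def)
  next
    case False
    have "?p w = ?p (cmod w *\<^sub>R sgn w)" using False by (simp add: sgn_div_norm)
    also have "\<dots> = cmod w * ?p (sgn w)"
      by (simp only: inner_scaleR_right) (rule L2_set_right_distrib[symmetric], simp)
    also have "\<dots> \<le> cmod w * ?p w0"
      using False by (intro mult_left_mono w0) (simp_all add: norm_sgn)
    finally show ?thesis by (simp add: mult.commute)
  qed
  moreover have "0 < ?p w0" using w0(1) by (intro pos) auto
  ultimately show ?thesis using that[of w0] w0(1) pos by simp
qed

theorem theorem1:
  fixes M :: "'a measure" and N :: "'b measure"
    and \<epsilon> :: "nat \<Rightarrow> 'a \<Rightarrow> real" and g :: "nat \<Rightarrow> 'b \<Rightarrow> real"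
    and n :: nat and v :: "nat \<Rightarrow> real ^ 'd" and t :: real
  assumes "prob_space M" and "prob_space N"
    and "prob_space.indep_vars M (\<lambda>_. borel) \<epsilon> {1..n}"
    and "\<And>i. i \<in> {1..n} \<Longrightarrow> rademacher M (\<epsilon> i)"
    and "prob_space.indep_vars N (\<lambda>_. borel) g {1..n}"
    and "\<And>i. i \<in> {1..n} \<Longrightarrow> standard_gaussian N (g i)"
    and "n \<ge> 1"
    and "dim (span (v ` {1..n})) = 2"
    and "t > 0"
  shows "\<P>(\<omega> in M. norm (\<Sum>i = 1..n. \<epsilon> i \<omega> *\<^sub>R v i) \<ge> t)
         \<le> 3824 * \<P>(\<omega> in N. norm (\<Sum>i = 1..n. g i \<omega> *\<^sub>R v i) \<ge> t)"
proof -
  let ?I = "{1..n}"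
  \<comment> \<open>Both spaces have dimension 2, so the span of the vectors is isometric to the
    complex plane.\<close>
  obtain f :: "real ^ 'd \<Rightarrow> complex" and h where f: "linear f" "f ` span (v ` ?I) = UNIV"
    "\<And>x. x \<in> span (v ` ?I) \<Longrightarrow> norm (f x) = norm x"
  proof (rule isometries_subspaces[of "span (v ` ?I)" "UNIV :: complex set"])
    show "dim (span (v ` ?I)) = dim (UNIV :: complex set)" using assms(8) by simp
  qed auto
  have "span ((\<lambda>i. f (v i)) ` ?I) = UNIV"
    using f(2) linear_span_image[OF f(1), of "v ` ?I"] by (simp add: image_image)
  then obtain w0 where w0: "cmod w0 = 1" "0 < L2_set (\<lambda>i. f (v i) \<bullet> w0) ?I"
    "\<And>w. L2_set (\<lambda>i. f (v i) \<bullet> w) ?I \<le> L2_set (\<lambda>i. f (v i) \<bullet> w0) ?I * cmod w"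
    "\<And>w. w \<noteq> 0 \<Longrightarrow> 0 < L2_set (\<lambda>i. f (v i) \<bullet> w) ?I"
    by (rule L2_set_inner_max_on_circle[rotated]) auto
  define \<tau> where "\<tau> = L2_set (\<lambda>i. f (v i) \<bullet> w0) ?I"
  have \<tau>: "0 < \<tau>" using w0 by (simp add: \<tau>_def)
  \<comment> \<open>Dividing by the maximal standard deviation \<open>\<tau>\<close> gives the
    normalization of the planar case; the threshold becomes \<open>t / \<tau>\<close>.\<close>
  define z where "z i = (1 / \<tau>) *\<^sub>R f (v i)" for i
  have p: "L2_set (\<lambda>i. z i \<bullet> w) ?I = (1 / \<tau>) * L2_set (\<lambda>i. f (v i) \<bullet> w) ?I" for w
    using \<tau> by (subst L2_set_right_distrib) (auto simp: z_def)
  have norm_eq: "t \<le> norm (\<Sum>i = 1..n. c i *\<^sub>R v i) \<longleftrightarrow> t / \<tau> \<le> cmod (\<Sum>i = 1..n. c i *\<^sub>R z i)" for c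
  proof -
    have "(\<Sum>i = 1..n. c i *\<^sub>R v i) \<in> span (v ` ?I)"
      by (intro span_sum span_scale span_base) auto
    then have "norm (\<Sum>i = 1..n. c i *\<^sub>R v i) = cmod (\<Sum>i = 1..n. c i *\<^sub>R f (v i))"
      using f(3) by (simp add: linear_sum[OF f(1)] linear_cmul[OF f(1)] flip: f(3))
    also have "(\<Sum>i = 1..n. c i *\<^sub>R f (v i)) = \<tau> *\<^sub>R (\<Sum>i = 1..n. c i *\<^sub>R z i)"
      using \<tau> by (simp add: z_def scaleR_sum_right)
    finally show ?thesis using \<tau> by (simp add: pos_divide_le_eq mult.commute)
  qed
  show ?thesis unfolding norm_eq
  proof (rule planar_rademacher_gaussian_tail)
    show "L2_set (\<lambda>i. z i \<bullet> w) ?I \<le> cmod w" for w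
      unfolding p using w0(3)[of w, folded \<tau>_def] \<tau> by (simp add: pos_divide_le_eq mult.commute)
    show "0 < L2_set (\<lambda>i. z i \<bullet> w) ?I" if "w \<noteq> 0" for w
      unfolding p using w0(4)[OF that] \<tau> by simp
    show "L2_set (\<lambda>i. z i \<bullet> w0) ?I = 1" unfolding p \<tau>_def[symmetric] using \<tau> by simp
  qed (use assms w0 in auto)
qed

end
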